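(* Let $k\geq 3$ be an integer and let $D$ be a strongly connected digraph. If $\chi(D)>(2k-2)(2k-3)$, then $D$ contains a subdivision of $B(k,1;1)$.
   Context: Digraphs are finite, without loops or parallel arcs (opposite arcs allowed). $\chi(D)$ is the chromatic number of the underlying undirected graph of $D$. A digraph is strongly connected if every vertex can reach every other vertex by a directed path. For positive integers $k_1,k_2,k_3$, a digraph $D$ contains a subdivision of $B(k_1,k_2;k_3)$ if there exist distinct vertices $x,y$ of $D$ and three pairwise internally vertex-disjoint directed paths in $D$: two from $x$ to $y$, of lengths (numbers of arcs) at least $k_1$ and at least $k_2$ respectively, and one from $y$ to $x$ of length at least $k_3$. *)

theory Defs
  imports Main
begin

text \<open>A digraph is a finite vertex set V with an arc set A \<subseteq> V \<times> V without loops.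
  Arcs are a set of ordered pairs, so there are no parallel arcs; opposite arcs are allowed.\<close>
definition digraph :: "'a set \<Rightarrow> ('a \<times> 'a) set \<Rightarrow> bool" where
  "digraph V A \<longleftrightarrow> finite V \<and> A \<subseteq> V \<times> V \<and> (\<forall>v. (v, v) \<notin> A)"

text \<open>Proper colouring of the underlying undirected graph with colours 0..n-1.\<close>
definition proper_colouring :: "'a set \<Rightarrow> ('a \<times> 'a) set \<Rightarrow> nat \<Rightarrow> ('a \<Rightarrow> nat) \<Rightarrow> bool" where
  "proper_colouring V A n c \<longleftrightarrow> (\<forall>v\<in>V. c v < n) \<and> (\<forall>(u, v)\<in>A. c u \<noteq> c v)"

definition chromatic_number :: "'a set \<Rightarrow> ('a \<times> 'a) set \<Rightarrow> nat" where
  "chromatic_number V A = (LEAST n. \<exists>c. proper_colouring V A n c)"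

definition strongly_connected :: "'a set \<Rightarrow> ('a \<times> 'a) set \<Rightarrow> bool" where
  "strongly_connected V A \<longleftrightarrow> (\<forall>u\<in>V. \<forall>v\<in>V. (u, v) \<in> A\<^sup>*)"

text \<open>A directed path given by its list of (distinct) vertices; its length is the number of arcs.\<close>
definition dpath :: "('a \<times> 'a) set \<Rightarrow> 'a list \<Rightarrow> 'a \<Rightarrow> 'a \<Rightarrow> bool" where
  "dpath A p x y \<longleftrightarrow> p \<noteq> [] \<and> hd p = x \<and> last p = y \<and> distinct p \<and>
     (\<forall>i. Suc i < length p \<longrightarrow> (p ! i, p ! Suc i) \<in> A)"

definition plen :: "'a list \<Rightarrow> nat" where
  "plen p = length p - 1"

text \<open>Subdivision of B(k1,k2;k3): distinct x y, two x-y paths of lengths \<ge> k1, \<ge> k2 and a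
  y-x path of length \<ge> k3, pairwise internally vertex-disjoint (they share only x and y).\<close>
definition contains_subdiv_B :: "('a \<times> 'a) set \<Rightarrow> nat \<Rightarrow> nat \<Rightarrow> nat \<Rightarrow> bool" where
  "contains_subdiv_B A k1 k2 k3 \<longleftrightarrow>
    (\<exists>x y P Q R. x \<noteq> y \<and> dpath A P x y \<and> dpath A Q x y \<and> dpath A R y x \<and>
       plen P \<ge> k1 \<and> plen Q \<ge> k2 \<and> plen R \<ge> k3 \<and>
       set P \<inter> set Q \<subseteq> {x, y} \<and> set P \<inter> set R \<subseteq> {x, y} \<and> set Q \<inter> set R \<subseteq> {x, y})"

end

theory Submission
  imports Defs "HOL-Combinatorics.Transposition"
begin

text \<open>
  Suppose that there is no subdivision of B(k,1;1). A directed cycle has no ear (a path leaving it at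
  x and returning at y) of length at least k, and none skipping at least k of its arcs.
  Starting from single vertices, we repeatedly glue disjoint blocks together along a cycle of length at
  least 2 k - 2 that meets each of them in one vertex. The bound on ears is inherited by the resulting
  cactus of cycles; hence all arcs between two of the glued blocks join vertices of the new cycle, and
  the cactus is (2 k - 2)-colourable as soon as each cycle is.
  Partition the vertices into as few blocks as possible. A cycle of length at least 2 k - 2 in the
  quotient digraph lifts to a cycle meeting each of its blocks in one vertex, for otherwise it would
  contain a long ear; so such a cycle would give a larger block. Hence the quotient has no such cycle and,
  by Bondy's theorem, it is (2 k - 3)-colourable. The product colouring uses (2 k - 2)(2 k - 3) colours.
\<close>

section \<open>Directed paths and cycles as lists of vertices\<close>

lemma dpath_iff:
  "dpath A p x y \<longleftrightarrow> p \<noteq> [] \<and> hd p = x \<and> last p = y \<and> distinct p \<and> successively (\<lambda>a b. (a, b) \<in> A) p"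
  by (auto simp: dpath_def successively_conv_nth)

lemma dpath_append:
  assumes "dpath A p x y" "dpath A q u v" "(y, u) \<in> A" "set p \<inter> set q = {}"
  shows "dpath A (p @ q) x v"
  using assms by (auto simp: dpath_iff successively_append_iff)

lemma dpath_join:
  assumes p: "dpath A p x y" and q: "dpath A q y z" and int: "set p \<inter> set q \<subseteq> {y}"
  obtains r where "dpath A r x z" "set r = set p \<union> set q" "plen r = plen p + plen q"
proof -
  obtain q' where q': "q = y # q'"
    using q by (cases q) (auto simp: dpath_iff)
  have "y \<in> set p"
    using p by (auto simp: dpath_iff)
  have "dpath A (p @ q') x z"
    using p q int q' by (cases q') (auto simp: dpath_iff successively_append_iff successively_Cons)
  moreover have "set (p @ q') = set p \<union> set q"
    using q' \<open>y \<in> set p\<close> by auto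
  moreover have "plen (p @ q') = plen p + plen q"
    using p q' by (cases p) (auto simp: plen_def dpath_iff)
  ultimately show thesis
    using that by blast
qed

lemma dpath_in_reachable:
  assumes "(x, y) \<in> (A \<inter> T \<times> T)\<^sup>*" "x \<in> T"
  obtains p where "dpath A p x y" "set p \<subseteq> T"
proof -
  from assms(1) have "\<exists>p. dpath A p x y \<and> set p \<subseteq> T"
  proof induction
    case base
    then show ?case
      using assms(2) by (intro exI[of _ "[x]"]) (auto simp: dpath_iff)
  next
    case (step y z)
    then obtain p where p: "dpath A p x y" "set p \<subseteq> T"
      by blast
    show ?case
    \<comment> \<open>If \<open>z\<close> is already on the path, the path is cut at
      \<open>z\<close>, which keeps the list distinct.\<close>
    proof (cases "z \<in> set p")
      case True
      then obtain ps qs where "p = ps @ z # qs"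
        by (auto simp: in_set_conv_decomp)
      then have "dpath A (ps @ [z]) x z \<and> set (ps @ [z]) \<subseteq> T"
        using p by (auto simp: dpath_iff successively_append_iff hd_append split: if_splits)
      then show ?thesis
        by blast
    next
      case False
      then have "dpath A (p @ [z]) x z \<and> set (p @ [z]) \<subseteq> T"
        using p step by (auto simp: dpath_iff successively_append_iff)
      then show ?thesis
        by blast
    qed
  qed
  then show thesis
    using that by blast
qed

lemma plen_pos:
  assumes "dpath A p x y" "x \<noteq> y"
  shows "1 \<le> plen p"
  using assms by (cases p; cases "tl p") (auto simp: dpath_iff plen_def split: if_splits)

text \<open>The first vertex is not repeated at the end, so the length of the list is the number of
  arcs. Two opposite arcs form a cycle of length 2.\<close>

definition dcycle :: "('a \<times> 'a) set \<Rightarrow> 'a list \<Rightarrow> bool" where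
  "dcycle A C \<longleftrightarrow> C \<noteq> [] \<and> distinct C \<and> successively (\<lambda>a b. (a, b) \<in> A) C \<and> (last C, hd C) \<in> A"

lemma dcycle_swap: "dcycle A (xs @ ys) \<Longrightarrow> dcycle A (ys @ xs)"
  by (cases "xs = []"; cases "ys = []") (auto simp: dcycle_def successively_append_iff)

lemma dcycle_segments:
  assumes "dcycle A (x # ps @ y # qs)"
  shows "dpath A (x # ps @ [y]) x y" "dpath A (y # qs @ [x]) y x"
  using assms
  by (auto simp: dpath_iff dcycle_def successively_append_iff successively_Cons hd_append split: if_splits)

lemma dcycle_hdE:
  assumes "dcycle A C" "x \<in> set C"
  obtains qs where "dcycle A (x # qs)" "set (x # qs) = set C" "length (x # qs) = length C"
proof -
  obtain us vs where C: "C = us @ x # vs"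
    using assms(2) by (auto simp: in_set_conv_decomp)
  show thesis
    by (rule that[of "vs @ us"]) (use assms(1) C dcycle_swap[of A us "x # vs"] in auto)
qed

lemma dcycle_splitE:
  assumes "dcycle A C" "x \<in> set C" "y \<in> set C" "x \<noteq> y"
  obtains ps qs where "dcycle A (x # ps @ y # qs)" "set (x # ps @ y # qs) = set C"
    "length ps + length qs + 2 = length C"
proof -
  obtain rs where rs: "dcycle A (x # rs)" "set (x # rs) = set C" "length (x # rs) = length C"
    using assms(1,2) by (rule dcycle_hdE)
  then have "y \<in> set rs"
    using assms(3,4) by auto
  then obtain ps qs where "rs = ps @ y # qs"
    by (auto simp: in_set_conv_decomp)
  then show thesis
    using rs that[of ps qs] by simp
qed

section \<open>Ears of cycles and blocks\<close>

locale bispindle_free =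
  fixes A :: "('a \<times> 'a) set" and k :: nat
  assumes three_le_k: "3 \<le> k"
    and loopless: "(v, v) \<notin> A"
    and no_bispindle: "\<not> contains_subdiv_B A k 1 1"
begin

text \<open>The ear, the segment of the cycle from \<open>x\<close> to \<open>y\<close> and the
  segment from \<open>y\<close> back to \<open>x\<close> form a bispindle as soon as one of the two
  paths from \<open>x\<close> to \<open>y\<close> has length at least \<open>k\<close>. Either may
  be the long one, hence the two bounds.\<close>

lemma ear_of_cycle_short:
  assumes C: "dcycle A (x # ps @ y # qs)"
    and E: "dpath A E x y" "set E \<inter> set (x # ps @ y # qs) \<subseteq> {x, y}"
  shows "plen E < k" "Suc (length ps) < k"
proof -
  have xy: "x \<noteq> y"
    using C by (auto simp: dcycle_def)
  note seg = dcycle_segments[OF C]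
  have len: "plen (x # ps @ [y]) = Suc (length ps)" "1 \<le> plen (y # qs @ [x])"
    by (auto simp: plen_def)
  have int: "set (x # ps @ [y]) \<inter> set (y # qs @ [x]) \<subseteq> {x, y}"
    "set E \<inter> set (x # ps @ [y]) \<subseteq> {x, y}" "set E \<inter> set (y # qs @ [x]) \<subseteq> {x, y}"
    using C E(2) by (auto simp: dcycle_def)
  have "contains_subdiv_B A k 1 1" if "k \<le> plen E"
    unfolding contains_subdiv_B_def
    by (rule exI[of _ x], rule exI[of _ y], rule exI[of _ E], rule exI[of _ "x # ps @ [y]"],
        rule exI[of _ "y # qs @ [x]"]) (use that xy E seg len int in simp)
  then show "plen E < k"
    using no_bispindle by force
  have "contains_subdiv_B A k 1 1" if "k \<le> Suc (length ps)"
    unfolding contains_subdiv_B_def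
    by (rule exI[of _ x], rule exI[of _ y], rule exI[of _ "x # ps @ [y]"], rule exI[of _ E],
        rule exI[of _ "y # qs @ [x]"])
      (use that xy E(1) seg len int plen_pos[OF E(1) xy] in \<open>simp add: Int_commute\<close>)
  then show "Suc (length ps) < k"
    using no_bispindle by force
qed

text \<open>Unrelated to 2-connectivity. The cactus structure itself is not recorded, only what
  gluing preserves and later steps use: paths inside \<open>T\<close>, no long ear of
  \<open>T\<close>, and a colouring with \<open>2 * k - 2\<close> colours.\<close>

definition block :: "'a set \<Rightarrow> bool" where
  "block T \<longleftrightarrow> T \<noteq> {} \<and> (\<forall>a\<in>T. \<forall>b\<in>T. (a, b) \<in> (A \<inter> T \<times> T)\<^sup>*)
    \<and> (\<forall>a\<in>T. \<forall>b\<in>T. \<forall>p. a \<noteq> b \<longrightarrow> dpath A p a b \<longrightarrow> set p \<inter> T \<subseteq> {a, b} \<longrightarrow> plen p < k)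
    \<and> (\<exists>c. proper_colouring T (A \<inter> T \<times> T) (2 * k - 2) c)"

lemma block_path:
  assumes "block T" "a \<in> T" "b \<in> T"
  obtains p where "dpath A p a b" "set p \<subseteq> T"
proof -
  have "(a, b) \<in> (A \<inter> T \<times> T)\<^sup>*"
    using assms by (simp add: block_def)
  then show thesis
    using assms(2) that by (rule dpath_in_reachable)
qed

lemma block_ear:
  assumes "block T" "a \<in> T" "b \<in> T" "a \<noteq> b" "dpath A p a b" "set p \<inter> T \<subseteq> {a, b}"
  shows "plen p < k"
  using assms unfolding block_def by blast

lemma block_singleton: "block {v}"
proof -
  have "A \<inter> {v} \<times> {v} = {}"
    using loopless by auto
  moreover have "proper_colouring {v} {} (2 * k - 2) (\<lambda>_. 0)"
    using three_le_k by (auto simp: proper_colouring_def)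
  ultimately show ?thesis
    by (auto simp: block_def)
qed

section \<open>Gluing blocks along a long cycle\<close>

context
  fixes C :: "'a list" and T :: "'a \<Rightarrow> 'a set"
  assumes C: "dcycle A C"
    and T: "\<And>x. x \<in> set C \<Longrightarrow> block (T x)"
    and mem_T: "\<And>x. x \<in> set C \<Longrightarrow> x \<in> T x"
    and disj: "\<And>x y. x \<in> set C \<Longrightarrow> y \<in> set C \<Longrightarrow> x \<noteq> y \<Longrightarrow> T x \<inter> T y = {}"
begin

lemma cycle_Int_block:
  assumes "x \<in> set C" "z \<in> set C" "z \<in> T x"
  shows "z = x"
  using assms disj[of x z] mem_T[of z] by auto

text \<open>Paths inside the two blocks, from \<open>x\<close> to \<open>a\<close> and from
  \<open>b\<close> to \<open>y\<close>, prolong \<open>E\<close>. As the blocks are disjoint and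
  each meets the cycle in its own vertex only, the result is an ear of the cycle.\<close>

lemma ear_of_blocks_extends:
  assumes xy: "x \<in> set C" "y \<in> set C" "x \<noteq> y" and ab: "a \<in> T x" "b \<in> T y"
    and E: "dpath A E a b" "set E \<inter> (\<Union>z\<in>set C. T z) \<subseteq> {a, b}"
  obtains F where "dpath A F x y" "set F \<inter> set C \<subseteq> {x, y}" "plen E \<le> plen F"
proof -
  obtain p where p: "dpath A p x a" "set p \<subseteq> T x"
    using block_path[OF T mem_T ab(1)] xy by blast
  obtain q where q: "dpath A q b y" "set q \<subseteq> T y"
    using block_path[OF T ab(2) mem_T] xy by blast
  note d = disj[OF xy]
  have "set p \<inter> set E \<subseteq> {a}"
    using p(2) E(2) xy ab d by blast
  then obtain r where r: "dpath A r x b" "set r = set p \<union> set E" "plen r = plen p + plen E"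
    by (rule dpath_join[OF p(1) E(1)])
  have "set r \<inter> set q \<subseteq> {b}"
    using p(2) q(2) E(2) r(2) xy ab d by blast
  then obtain F where F: "dpath A F x y" "set F = set r \<union> set q" "plen F = plen r + plen q"
    by (rule dpath_join[OF r(1) q(1)])
  have "z = x \<or> z = y" if "z \<in> set F" "z \<in> set C" for z
  proof -
    have "z \<in> T x \<or> z \<in> T y"
      using that F(2) r(2) p(2) q(2) E(2) mem_T[of z] ab by blast
    then show ?thesis
      using cycle_Int_block xy that by blast
  qed
  then show thesis
    using that[of F] F r by auto
qed

text \<open>The arc prolongs to an ear of the cycle, so the cycle runs from \<open>x\<close> to
  \<open>y\<close> in at most \<open>k - 1\<close> steps and, being of length at least
  \<open>2 * k - 2\<close>, takes at least \<open>k - 1\<close> steps for the way back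
  \<open>G\<close>. If \<open>a \<noteq> x\<close>, the arc, a path in \<open>T y\<close> and
  \<open>G\<close> form an ear of \<open>T x\<close> of length at least \<open>k\<close>; if
  \<open>b \<noteq> y\<close>, then \<open>G\<close> and the arc form such an ear of
  \<open>T y\<close>.\<close>

lemma arc_between_blocks:
  assumes len: "2 * k - 2 \<le> length C"
    and xy: "x \<in> set C" "y \<in> set C" "x \<noteq> y"
    and ab: "a \<in> T x" "b \<in> T y" "(a, b) \<in> A"
  shows "a = x \<and> b = y"
proof -
  note d = disj[OF xy]
  have "a \<noteq> b"
    using ab d by auto
  then have "dpath A [a, b] a b" "set [a, b] \<inter> (\<Union>z\<in>set C. T z) \<subseteq> {a, b}"
    using ab by (auto simp: dpath_iff)
  then obtain F where F: "dpath A F x y" "set F \<inter> set C \<subseteq> {x, y}"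
    by (rule ear_of_blocks_extends[OF xy ab(1,2)])
  obtain ps qs where pq: "dcycle A (x # ps @ y # qs)" "set (x # ps @ y # qs) = set C"
    "length ps + length qs + 2 = length C"
    using dcycle_splitE[OF C xy] .
  have "Suc (length ps) < k"
    using ear_of_cycle_short(2)[OF pq(1) F(1)] F(2) pq(2) by simp
  define G where "G = y # qs @ [x]"
  have G: "dpath A G y x" "set G \<subseteq> set C"
    using dcycle_segments(2)[OF pq(1)] pq(2) by (auto simp: G_def)
  have plen_G: "k - 1 \<le> plen G"
    using \<open>Suc (length ps) < k\<close> pq(3) len by (simp add: G_def plen_def)
  have G_x: "set G \<inter> T x \<subseteq> {x}" and G_y: "set G \<inter> T y \<subseteq> {y}"
    using cycle_Int_block xy G(2) by blast+
  have a: "a = x"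
  proof (rule ccontr)
    assume "a \<noteq> x"
    obtain q where q: "dpath A q b y" "set q \<subseteq> T y"
      using block_path[OF T ab(2) mem_T] xy by blast
    then have "set q \<inter> set G \<subseteq> {y}"
      using G_y by blast
    then obtain r where r: "dpath A r b x" "set r = set q \<union> set G" "plen r = plen q + plen G"
      by (rule dpath_join[OF q(1) G(1)])
    have int: "set r \<inter> T x \<subseteq> {x}"
      using r(2) q(2) d G_x by blast
    have "dpath A ([a] @ r) a x"
      by (rule dpath_append[of _ _ _ a _ b])
        (use r(1) ab int \<open>a \<noteq> x\<close> in \<open>auto simp: dpath_iff\<close>)
    moreover have "set ([a] @ r) \<inter> T x \<subseteq> {a, x}"
      using int by auto
    ultimately have "plen ([a] @ r) < k"
      using block_ear[OF T ab(1) mem_T \<open>a \<noteq> x\<close>] xy by blast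
    moreover have "r \<noteq> []"
      using r(1) by (auto simp: dpath_iff)
    ultimately show False
      using r(3) plen_G by (cases r) (auto simp: plen_def)
  qed
  have "b = y"
  proof (rule ccontr)
    assume "b \<noteq> y"
    \<comment> \<open>Since \<open>a = x\<close> by now, the arc starts at the end of
      \<open>G\<close>.\<close>
    have "dpath A (G @ [b]) y b"
      by (rule dpath_append[of _ _ _ x _ b])
        (use G(1) ab a G_y \<open>b \<noteq> y\<close> in \<open>auto simp: dpath_iff\<close>)
    moreover have "set (G @ [b]) \<inter> T y \<subseteq> {y, b}"
      using G_y by auto
    ultimately have "plen (G @ [b]) < k"
      using block_ear[OF T mem_T ab(2)] \<open>b \<noteq> y\<close> xy by blast
    then show False
      using plen_G by (auto simp: plen_def G_def)
  qed
  with a show ?thesis ..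
qed

text \<open>The route runs inside one block to its vertex on the cycle, then along the cycle, then
  inside the other block.\<close>

lemma Union_blocks_strong:
  assumes "a \<in> (\<Union>x\<in>set C. T x)" "b \<in> (\<Union>x\<in>set C. T x)"
  shows "(a, b) \<in> (A \<inter> (\<Union>x\<in>set C. T x) \<times> (\<Union>x\<in>set C. T x))\<^sup>*"
proof -
  define U where "U = (\<Union>x\<in>set C. T x)"
  define R where "R = (A \<inter> U \<times> U)\<^sup>*"
  obtain x y where xy: "x \<in> set C" "a \<in> T x" "y \<in> set C" "b \<in> T y"
    using assms by blast
  have in_block: "(u, v) \<in> R" if "z \<in> set C" "u \<in> T z" "v \<in> T z" for u v z
  proof -
    have "(u, v) \<in> (A \<inter> T z \<times> T z)\<^sup>*"
      using T[OF that(1)] that by (auto simp: block_def)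
    moreover have "(A \<inter> T z \<times> T z)\<^sup>* \<subseteq> R"
      unfolding R_def using that(1) by (intro rtrancl_mono) (auto simp: U_def)
    ultimately show ?thesis
      by blast
  qed
  have path_R: "(u, v) \<in> R" if "dpath A p u v" "set p \<subseteq> U" for p u v
    using that
  proof (induction p arbitrary: u)
    case Nil
    then show ?case
      by (simp add: dpath_iff)
  next
    case (Cons z p)
    show ?case
    proof (cases "p = []")
      case True
      then show ?thesis
        using Cons by (auto simp: dpath_iff R_def)
    next
      case False
      then have "dpath A p (hd p) v" "(z, hd p) \<in> A" "hd p \<in> U" "z \<in> U" "z = u"
        using Cons.prems by (auto simp: dpath_iff successively_Cons)
      then show ?thesis
        using Cons.IH[of "hd p"] Cons.prems(2) by (auto simp: R_def intro: converse_rtrancl_into_rtrancl)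
    qed
  qed
  have "(x, y) \<in> R"
  proof (cases "x = y")
    case False
    then obtain ps qs where pq: "dcycle A (x # ps @ y # qs)" "set (x # ps @ y # qs) = set C"
      using dcycle_splitE[OF C xy(1,3)] by blast
    show ?thesis
    proof (rule path_R)
      show "dpath A (x # ps @ [y]) x y"
        using dcycle_segments(1)[OF pq(1)] .
      show "set (x # ps @ [y]) \<subseteq> U"
        using pq(2) mem_T by (fastforce simp: U_def)
    qed
  qed (simp add: R_def)
  moreover have "(a, x) \<in> R" "(y, b) \<in> R"
    using in_block xy mem_T by blast+
  ultimately show ?thesis
    unfolding R_def U_def[symmetric] by (meson rtrancl_trans)
qed

text \<open>An ear with both ends in one block is an ear of that block; any other prolongs to an ear
  of the cycle that is at least as long.\<close>

lemma Union_blocks_ear: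
  assumes ab: "a \<in> (\<Union>x\<in>set C. T x)" "b \<in> (\<Union>x\<in>set C. T x)" "a \<noteq> b"
    and p: "dpath A p a b" "set p \<inter> (\<Union>x\<in>set C. T x) \<subseteq> {a, b}"
  shows "plen p < k"
proof -
  obtain x y where xy: "x \<in> set C" "a \<in> T x" "y \<in> set C" "b \<in> T y"
    using ab by blast
  show ?thesis
  proof (cases "x = y")
    case True
    have "set p \<inter> T x \<subseteq> {a, b}"
      using p(2) xy(1) by blast
    then show ?thesis
      using block_ear[OF T, of x a b p] xy ab(3) p(1) True by blast
  next
    case False
    then obtain F where F: "dpath A F x y" "set F \<inter> set C \<subseteq> {x, y}" "plen p \<le> plen F"
      using ear_of_blocks_extends[OF xy(1,3) _ xy(2,4) p] by blast
    obtain ps qs where pq: "dcycle A (x # ps @ y # qs)" "set (x # ps @ y # qs) = set C"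
      using dcycle_splitE[OF C xy(1,3) False] by blast
    then show ?thesis
      using ear_of_cycle_short(1)[OF pq(1) F(1)] F(2,3) by simp
  qed
qed

text \<open>By \<open>arc_between_blocks\<close>, arcs between different blocks join vertices of
  \<open>C\<close>. Hence it is enough to permute the colours of each block so that its vertex on
  the cycle receives its colour under \<open>c\<close>.\<close>

lemma Union_blocks_colouring:
  assumes len: "2 * k - 2 \<le> length C"
    and c: "proper_colouring (set C) (A \<inter> set C \<times> set C) (2 * k - 2) c"
  shows "\<exists>c. proper_colouring (\<Union>x\<in>set C. T x)
    (A \<inter> (\<Union>x\<in>set C. T x) \<times> (\<Union>x\<in>set C. T x)) (2 * k - 2) c"
proof -
  have "\<forall>x\<in>set C. \<exists>d. proper_colouring (T x) (A \<inter> T x \<times> T x) (2 * k - 2) d"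
    using T by (auto simp: block_def)
  then obtain d where d: "\<And>x. x \<in> set C \<Longrightarrow> proper_colouring (T x) (A \<inter> T x \<times> T x) (2 * k - 2) (d x)"
    by metis
  define own where "own v = (SOME x. x \<in> set C \<and> v \<in> T x)" for v
  have own: "own v = x" if "x \<in> set C" "v \<in> T x" for x v
    unfolding own_def using that disj by (intro some_equality) blast+
  \<comment> \<open>In the block of \<open>x\<close>, the transposition exchanges the colour of
    \<open>x\<close> there with \<open>c x\<close>, so \<open>f\<close> agrees with \<open>c\<close>
    on the cycle.\<close>
  define f where "f v = transpose (d (own v) (own v)) (c (own v)) (d (own v) v)" for v
  have f: "f v = transpose (d x x) (c x) (d x v)" if "x \<in> set C" "v \<in> T x" for x v
    using own[OF that] by (simp add: f_def)
  have bound: "f v < 2 * k - 2" if "x \<in> set C" "v \<in> T x" for x v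
    using f[OF that] d[OF that(1)] c that mem_T[OF that(1)]
    by (auto simp: proper_colouring_def transpose_def)
  have proper: "f a \<noteq> f b" if "x \<in> set C" "a \<in> T x" "y \<in> set C" "b \<in> T y" "(a, b) \<in> A" for x y a b
  proof (cases "x = y")
    case True
    then have "d x a \<noteq> d x b"
      using d[OF that(1)] that by (auto simp: proper_colouring_def)
    then show ?thesis
      using f that True by (metis transpose_involutory)
  next
    case False
    then have "a = x" "b = y"
      using arc_between_blocks[OF len, of x y a b] that by auto
    moreover have "c x \<noteq> c y"
      using c that calculation by (auto simp: proper_colouring_def)
    ultimately show ?thesis
      using f that by simp
  qed
  have "proper_colouring (\<Union>x\<in>set C. T x)
    (A \<inter> (\<Union>x\<in>set C. T x) \<times> (\<Union>x\<in>set C. T x)) (2 * k - 2) f"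
    using bound proper by (auto simp: proper_colouring_def)
  then show ?thesis
    by blast
qed

lemma Union_blocks:
  assumes "2 * k - 2 \<le> length C" "\<exists>c. proper_colouring (set C) (A \<inter> set C \<times> set C) (2 * k - 2) c"
  shows "block (\<Union>x\<in>set C. T x)"
proof -
  have "(\<Union>x\<in>set C. T x) \<noteq> {}"
    using C mem_T by (cases C) (auto simp: dcycle_def)
  then show ?thesis
    using Union_blocks_strong Union_blocks_ear Union_blocks_colouring[OF assms(1)] assms(2)
    unfolding block_def by (intro conjI ballI allI impI) metis+
qed

end

end

section \<open>Colouring the vertices of a long cycle\<close>

text \<open>The numbers below \<open>n\<close> stand for the positions on a cycle. Equal colours at
  least \<open>k\<close> apart in both directions cannot be joined by an arc, by
  \<open>chord_short\<close>.\<close>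

lemma cyclic_distance_colouring:
  fixes k n :: nat
  assumes "3 \<le> k" "2 * k \<le> n"
  obtains g :: "nat \<Rightarrow> nat" where "\<And>i. i < n \<Longrightarrow> g i < 2 * k - 2"
    and "\<And>i j. i < j \<Longrightarrow> j < n \<Longrightarrow> g i = g j \<Longrightarrow> k \<le> j - i \<and> k \<le> n - (j - i)"
proof -
  define r where "r = n mod k"
  define s where "s = 2 * k + r"
  define h where "h = s div 2"
  \<comment> \<open>Cut the cyclic sequence into segments of lengths h, s - h, k, ..., k; each has length at
    least k and at most 2 k - 2, and is coloured 0, 1, 2, ... in order.\<close>
  define g where "g i = (if i < h then i else if i < s then i - h else (i - s) mod k)" for i
  have r: "r < k"
    using assms by (simp add: r_def)
  \<comment> \<open>As \<open>s\<close> is less than \<open>3 * k\<close>, both halves have length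
    at most \<open>3 * k div 2\<close>, which is at most \<open>2 * k - 2\<close> because
    \<open>3 \<le> k\<close>.\<close>
  have h: "k \<le> h" "k \<le> s - h" "h \<le> s" "h \<le> 2 * k - 2" "s - h \<le> 2 * k - 2"
    using r assms(1) by (auto simp: h_def s_def)
  have "k dvd n - r"
    by (simp add: r_def)
  then have "k dvd n - s"
    unfolding s_def by (metis add.commute diff_diff_left dvd_diff_nat dvd_triv_right)
  then obtain q where q: "n - s = k * q"
    by blast
  have "2 \<le> n div k"
    using div_le_mono[OF assms(2), of k] assms(1) by simp
  then have "2 * k + n mod k \<le> n"
    by (metis add_le_cancel_right div_mult_mod_eq mult_le_mono1)
  then have s: "s \<le> n"
    by (simp add: s_def r_def)
  show thesis
  proof (rule that)
    fix i
    assume "i < n"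
    have "(i - s) mod k < 2 * k - 2"
      by (rule less_le_trans[OF mod_less_divisor]) (use assms(1) in auto)
    then show "g i < 2 * k - 2"
      using h assms(1) by (auto simp: g_def)
  next
    fix i j
    assume ij: "i < j" "j < n" "g i = g j"
    show "k \<le> j - i \<and> k \<le> n - (j - i)"
    proof (cases "j < s")
      case True
      then have "i < h" "j = i + h"
        using ij by (auto simp: g_def split: if_splits)
      then show ?thesis
        using h s by auto
    next
      case False
      define a t where "a = (j - s) div k" and "t = (j - s) mod k"
      have j: "j = s + a * k + t" and t: "t < k" "g j = t"
        using False h assms(1) by (auto simp: a_def t_def g_def)
      have "a * k < k * q"
        using ij(2) j q by linarith
      then have "a < q"
        by (simp add: mult.commute)
      then have "a * k + k \<le> k * q"
        by (metis Suc_leI add.commute mult.commute mult_Suc mult_le_mono1)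
      \<comment> \<open>The segment of \<open>j\<close> starts at \<open>j - t\<close> and ends by
        \<open>n\<close>. As a position of colour \<open>t\<close> is at least \<open>t\<close>,
        this bounds the distance from \<open>j\<close> to \<open>i\<close> across the end of the
        sequence.\<close>
      then have jn: "j + k \<le> n + t"
        using j q s by linarith
      show ?thesis
      proof (cases "i < s")
        case True
        then have "i = t \<or> i = h + t"
          using ij(3) t by (auto simp: g_def split: if_splits)
        then show ?thesis
          using j jn h t by auto
      next
        case False
        define b where "b = (i - s) div k"
        have i: "i = s + b * k + t"
          using False h ij(3) t assms(1) div_mult_mod_eq[of "i - s" k] by (auto simp: b_def g_def)
        then have "b * k < a * k"
          using ij(1) j by simp
        then have "b < a"
          by simp
        then have "b * k + k \<le> a * k"
          by (metis Suc_leI add.commute mult_Suc mult_le_mono1)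
        then show ?thesis
          using i j jn h by auto
      qed
    qed
  qed
qed

context bispindle_free
begin

text \<open>A chord is an ear of length 1, so the stretch of the cycle that it skips is shorter than
  \<open>k\<close>. A backward chord skips the stretch that passes through the end of the list,
  whence the complementary length.\<close>

lemma chord_short:
  assumes C: "dcycle A C" and ij: "i < j" "j < length C"
  shows "(C ! i, C ! j) \<in> A \<Longrightarrow> j - i < k" "(C ! j, C ! i) \<in> A \<Longrightarrow> length C - (j - i) < k"
proof -
  define ps where "ps = take (j - Suc i) (drop (Suc i) C)"
  define qs where "qs = drop (Suc j) C @ take i C"
  have len: "length ps = j - Suc i" "length qs = length C - Suc j + i"
    using ij by (auto simp: ps_def qs_def)
  have "drop (Suc i) C = ps @ C ! j # drop (Suc j) C"
    using ij id_take_nth_drop[of "j - Suc i" "drop (Suc i) C"] by (simp add: ps_def)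
  then have "C = take i C @ (C ! i # ps @ C ! j # drop (Suc j) C)"
    using ij id_take_nth_drop[of i C] by simp
  then have 1: "dcycle A (C ! i # ps @ C ! j # qs)"
    using dcycle_swap[of A "take i C" "C ! i # ps @ C ! j # drop (Suc j) C"] C by (simp add: qs_def)
  then have 2: "dcycle A (C ! j # qs @ C ! i # ps)"
    using dcycle_swap[of A "C ! i # ps" "C ! j # qs"] by simp
  have ne: "C ! i \<noteq> C ! j"
    using C ij by (simp add: dcycle_def nth_eq_iff_index_eq)
  show "j - i < k" if "(C ! i, C ! j) \<in> A"
    using ear_of_cycle_short(2)[OF 1, of "[C ! i, C ! j]"] that ne len ij by (auto simp: dpath_iff)
  show "length C - (j - i) < k" if "(C ! j, C ! i) \<in> A"
    using ear_of_cycle_short(2)[OF 2, of "[C ! j, C ! i]"] that ne len ij by (auto simp: dpath_iff)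
qed

lemma cycle_colouring_by_position:
  assumes C: "dcycle A C" and g: "\<And>i. i < length C \<Longrightarrow> g i < N"
    and nonadj: "\<And>i j. i < j \<Longrightarrow> j < length C \<Longrightarrow> g i = g j \<Longrightarrow> (C ! i, C ! j) \<notin> A \<and> (C ! j, C ! i) \<notin> A"
  shows "\<exists>c. proper_colouring (set C) (A \<inter> set C \<times> set C) N c"
proof -
  have "\<forall>v\<in>set C. \<exists>i. i < length C \<and> C ! i = v"
    by (auto simp: in_set_conv_nth)
  then obtain idx where idx: "\<And>v. v \<in> set C \<Longrightarrow> idx v < length C \<and> C ! idx v = v"
    using bchoice[of "set C" "\<lambda>v i. i < length C \<and> C ! i = v"] by blast
  have "g (idx u) \<noteq> g (idx v)" if uv: "u \<in> set C" "v \<in> set C" "(u, v) \<in> A" for u v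
  proof (cases "idx u" "idx v" rule: linorder_cases)
    case less
    then show ?thesis
      using nonadj[of "idx u" "idx v"] idx uv by auto
  next
    case equal
    then have "u = v"
      using idx[OF uv(1)] idx[OF uv(2)] by metis
    then show ?thesis
      using uv(3) loopless by blast
  next
    case greater
    then show ?thesis
      using nonadj[of "idx v" "idx u"] idx uv by force
  qed
  then have "proper_colouring (set C) (A \<inter> set C \<times> set C) N (\<lambda>v. g (idx v))"
    using g idx by (auto simp: proper_colouring_def)
  then show ?thesis
    by blast
qed

text \<open>If all pairs were adjacent, the arcs from 0 to 2, 1 to k, k to 0, k - 1 to k + 1 and k + 1 to 1
  (numbering the vertices along the cycle) would give a bispindle with 0 and 1 as its ends.\<close>
lemma nonadjacent_pair_on_cycle:
  assumes C: "dcycle A C" and len: "length C = 2 * k - 1"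
  shows "\<exists>i j. i < j \<and> j < length C \<and> (C ! i, C ! j) \<notin> A \<and> (C ! j, C ! i) \<notin> A"
proof (rule ccontr)
  assume "\<not> ?thesis"
  then have adj: "(C ! i, C ! j) \<in> A \<or> (C ! j, C ! i) \<in> A" if "i < j" "j < length C" for i j
    using that by blast
  \<comment> \<open>On a cycle with \<open>2 * k - 1\<close> arcs exactly one of the two ways
    between two positions has length below \<open>k\<close>, so the direction of every chord is
    forced.\<close>
  have fwd: "(C ! i, C ! j) \<in> A" if "i < j" "j < length C" "j - i < k" for i j
    using adj[OF that(1,2)] chord_short(2)[OF C that(1,2)] that len by auto
  have bwd: "(C ! j, C ! i) \<in> A" if "i < j" "j < length C" "k \<le> j - i" for i j
    using adj[OF that(1,2)] chord_short(1)[OF C that(1,2)] that by auto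
  have eq: "C ! i = C ! j \<longleftrightarrow> i = j" if "i < length C" "j < length C" for i j
    using C that by (simp add: dcycle_def nth_eq_iff_index_eq)
  \<comment> \<open>These are \<open>k + 1\<close> positions, so the path has length
    \<open>k\<close>. Position \<open>k\<close> is left to the return path, and \<open>Suc k\<close>
    lies on the cycle because \<open>3 \<le> k\<close>.\<close>
  define I where "I = 0 # [2..<k] @ [Suc k, 1]"
  have I: "distinct I" "set I \<subseteq> {..<length C}" "I \<noteq> []" "hd I = 0" "last I = 1" "k \<notin> set I"
    "length I = Suc k"
    using three_le_k len by (auto simp: I_def)
  define P where "P = map ((!) C) I"
  have "successively (\<lambda>i j. (C ! i, C ! j) \<in> A) [2..<k]"
    using fwd three_le_k len by (auto simp: successively_conv_nth)
  moreover have "last [2..<k] = k - 1" "hd [2..<k] = 2" "[2..<k] \<noteq> []"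
    using three_le_k by auto
  ultimately have "successively (\<lambda>i j. (C ! i, C ! j) \<in> A) I"
    using fwd[of 0 2] fwd[of "k - 1" "Suc k"] bwd[of 1 "Suc k"] three_le_k len
    by (auto simp: I_def successively_append_iff successively_Cons)
  moreover have "inj_on ((!) C) (set I)"
    using I(2) eq by (intro inj_onI) (metis lessThan_iff subsetD)
  ultimately have P: "dpath A P (C ! 0) (C ! 1)"
    using I by (auto simp: P_def dpath_iff successively_map hd_map last_map distinct_map)
  have lt: "0 < length C" "1 < length C" "k < length C"
    using three_le_k len by auto
  have ne: "C ! 0 \<noteq> C ! 1" "C ! 0 \<noteq> C ! k" "C ! 1 \<noteq> C ! k"
    using eq[of 0 1] eq[of 0 k] eq[of 1 k] three_le_k lt by auto
  have Q: "dpath A [C ! 0, C ! 1] (C ! 0) (C ! 1)"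
    using fwd[of 0 1] ne three_le_k lt by (auto simp: dpath_iff)
  have R: "dpath A [C ! 1, C ! k, C ! 0] (C ! 1) (C ! 0)"
    using fwd[of 1 k] bwd[of 0 k] ne three_le_k lt by (auto simp: dpath_iff)
  have "C ! k \<notin> set P"
  proof
    assume "C ! k \<in> set P"
    then obtain i where "i \<in> set I" "C ! k = C ! i"
      by (auto simp: P_def)
    then show False
      using I(2,6) eq[of k i] lt by auto
  qed
  moreover have "k \<le> plen P"
    using I(7) by (simp add: P_def plen_def)
  ultimately have "contains_subdiv_B A k 1 1"
    unfolding contains_subdiv_B_def
    by (intro exI[of _ "C ! 0"] exI[of _ "C ! 1"] exI[of _ P] exI[of _ "[C ! 0, C ! 1]"]
        exI[of _ "[C ! 1, C ! k, C ! 0]"]) (use P Q R ne in \<open>auto simp: plen_def\<close>)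
  then show False
    using no_bispindle by blast
qed

text \<open>With \<open>2 * k - 2\<close> vertices all colours can differ; with one more, a
  nonadjacent pair shares a colour; on longer cycles colours are repeated only at large cyclic
  distance.\<close>

lemma cycle_colouring:
  assumes C: "dcycle A C" and len: "2 * k - 2 \<le> length C"
  shows "\<exists>c. proper_colouring (set C) (A \<inter> set C \<times> set C) (2 * k - 2) c"
proof -
  consider "length C = 2 * k - 2" | "length C = 2 * k - 1" | "2 * k \<le> length C"
    using len by linarith
  then show ?thesis
  proof cases
    case 1
    then show ?thesis
      by (intro cycle_colouring_by_position[OF C, of "\<lambda>i. i"]) auto
  next
    case 2
    obtain i j where ij: "i < j" "j < length C" "(C ! i, C ! j) \<notin> A" "(C ! j, C ! i) \<notin> A"
      using nonadjacent_pair_on_cycle[OF C 2] by blast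
    \<comment> \<open>Position \<open>j\<close> takes the colour of \<open>i\<close>, and the
      colours of later positions move down by one to close the gap.\<close>
    show ?thesis
      by (rule cycle_colouring_by_position[OF C,
            of "\<lambda>l. if l < j then l else if l = j then i else l - 1"])
        (use ij 2 in \<open>auto split: if_splits\<close>)
  next
    case 3
    obtain g where g: "\<And>i. i < length C \<Longrightarrow> g i < 2 * k - 2"
      "\<And>i j. i < j \<Longrightarrow> j < length C \<Longrightarrow> g i = g j \<Longrightarrow> k \<le> j - i \<and> k \<le> length C - (j - i)"
      using cyclic_distance_colouring[OF three_le_k 3] by blast
    show ?thesis
      by (rule cycle_colouring_by_position[OF C, of g]) (use g chord_short[OF C] in \<open>metis not_le\<close>)+
  qed
qed

end

section \<open>Cycle weights and Bondy's theorem\<close>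

fun walk_weight :: "('a \<times> 'a \<Rightarrow> int) \<Rightarrow> 'a list \<Rightarrow> int" where
  "walk_weight w (x # y # p) = w (x, y) + walk_weight w (y # p)"
| "walk_weight w _ = 0"

lemma walk_weight_append: "walk_weight w (p @ x # q) = walk_weight w (p @ [x]) + walk_weight w (x # q)"
  by (induction w p rule: walk_weight.induct) auto

lemma walk_weight_snoc: "p \<noteq> [] \<Longrightarrow> walk_weight w (p @ [x]) = walk_weight w p + w (last p, x)"
  by (induction w p rule: walk_weight.induct) auto

lemma walk_weight_mono: "(\<And>e. w e \<le> w' e) \<Longrightarrow> walk_weight w p \<le> walk_weight w' p"
  by (induction w p rule: walk_weight.induct) (auto intro: add_mono)

lemma walk_weight_affine:
  "p \<noteq> [] \<Longrightarrow> walk_weight (\<lambda>e. b - m * w e) p = b * (int (length p) - 1) - m * walk_weight w p"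
  by (induction w p rule: walk_weight.induct) (auto simp: algebra_simps)

lemma walk_weight_fun_upd:
  "(\<exists>xs ys. p = xs @ u # v # ys) \<or> walk_weight (w((u, v) := z)) p = walk_weight w p"
proof (induction w p rule: walk_weight.induct)
  case (1 w x y p)
  show ?case
  proof (cases "x = u \<and> y = v")
    case True
    then have "x # y # p = [] @ u # v # p"
      by simp
    then show ?thesis
      by blast
  next
    case False
    from 1 show ?thesis
    proof
      assume "\<exists>xs ys. y # p = xs @ u # v # ys"
      then obtain xs ys where "y # p = xs @ u # v # ys"
        by blast
      then have "x # y # p = (x # xs) @ u # v # ys"
        by simp
      then show ?thesis
        by blast
    qed (use False in auto)
  qed
qed auto

definition cycle_weight :: "('a \<times> 'a \<Rightarrow> int) \<Rightarrow> 'a list \<Rightarrow> int" where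
  "cycle_weight w C = walk_weight w (C @ [hd C])"

lemma cycle_weight_eq: "C \<noteq> [] \<Longrightarrow> cycle_weight w C = walk_weight w C + w (last C, hd C)"
  by (simp add: cycle_weight_def walk_weight_snoc)

lemma cycle_weight_swap: "cycle_weight w (xs @ ys) = cycle_weight w (ys @ xs)"
proof (cases "xs = [] \<or> ys = []")
  case False
  then obtain a xs' b ys' where "xs = a # xs'" "ys = b # ys'"
    by (meson list.exhaust)
  then show ?thesis
    using walk_weight_append[of w "a # xs'" b "ys' @ [a]"] walk_weight_append[of w "b # ys'" a "xs' @ [b]"]
    by (simp add: cycle_weight_def)
qed auto

text \<open>A cycle through the arc \<open>(u, v)\<close> can be rotated so that this arc closes it,
  the form that \<open>cycle_weight_fun_upd_last\<close> handles. The rotation preserves the weight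
  under every \<open>w\<close>, so it serves before and after an update.\<close>

lemma cycle_weight_fun_upd:
  assumes C: "dcycle A C"
  obtains "cycle_weight (w((u, v) := z)) C = cycle_weight w C"
  | C' where "dcycle A C'" "last C' = u" "hd C' = v" "\<And>w. cycle_weight w C' = cycle_weight w C"
proof -
  from walk_weight_fun_upd[of "C @ [hd C]" u v w z] show thesis
  proof
    assume "\<exists>xs ys. C @ [hd C] = xs @ u # v # ys"
    then obtain xs ys where eq: "C @ [hd C] = xs @ u # v # ys"
      by blast
    show thesis
    proof (cases ys rule: rev_cases)
      case Nil
      with eq have "C @ [hd C] = (xs @ [u]) @ [v]"
        by (simp only: append_assoc append_Cons append_Nil)
      then have "C = xs @ [u]" "hd C = v"
        unfolding append1_eq_conv by blast+
      then have "last C = u"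
        by simp
      with C \<open>hd C = v\<close> show thesis
        using that(2)[of C] by blast
    next
      case (snoc ys' z')
      with eq have "C = (xs @ [u]) @ (v # ys')"
        by simp
      with C show thesis
        using that(2)[of "(v # ys') @ (xs @ [u])"] dcycle_swap[of A "xs @ [u]" "v # ys'"]
          cycle_weight_swap[of _ "xs @ [u]" "v # ys'"] by simp
    qed
  qed (use that(1) in \<open>simp add: cycle_weight_def\<close>)
qed

text \<open>As the list is distinct and ends in \<open>u\<close>, the closing arc does not occur
  again between consecutive entries, and the update changes a single term.\<close>

lemma cycle_weight_fun_upd_last:
  assumes C: "dcycle A C" "last C = u" "hd C = v"
  shows "cycle_weight (w((u, v) := z)) C = cycle_weight w C - w (u, v) + z"
proof -
  have "C \<noteq> []"
    using C by (simp add: dcycle_def)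
  moreover have "\<not> (\<exists>xs ys. C = xs @ u # v # ys)"
  proof
    assume "\<exists>xs ys. C = xs @ u # v # ys"
    then obtain xs ys where "C = xs @ u # v # ys"
      by blast
    then have "u \<in> set (v # ys)" "distinct (u # v # ys)"
      using C last_in_set[of "v # ys"] by (auto simp: dcycle_def simp del: last_in_set)
    then show False
      by auto
  qed
  ultimately show ?thesis
    using walk_weight_fun_upd[of C u v w z] C(2,3) by (simp add: cycle_weight_eq)
qed

lemma dcycle_subset:
  assumes "dcycle A C" "A \<subseteq> V \<times> V"
  shows "set C \<subseteq> V"
proof
  fix x
  assume "x \<in> set C"
  with assms(1) obtain qs where "dcycle A (x # qs)"
    by (rule dcycle_hdE)
  then show "x \<in> V"
    using assms(2) by (auto simp: dcycle_def)
qed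

text \<open>The weights play the role of a coherent cyclic order of Bessy and Thomasse: the arcs are
  lightened one at a time, each as far as the positivity of all cycles allows.\<close>
lemma tight_weighting:
  assumes D: "digraph V A" "strongly_connected V A"
  obtains w where "\<And>C. dcycle A C \<Longrightarrow> 1 \<le> cycle_weight w C"
    and "\<And>u v. (u, v) \<in> A \<Longrightarrow> \<exists>C. dcycle A C \<and> last C = u \<and> hd C = v \<and> cycle_weight w C = 1"
proof -
  have AV: "A \<subseteq> V \<times> V" and finV: "finite V"
    using D(1) by (auto simp: digraph_def)
  define feasible where "feasible w \<longleftrightarrow> (\<forall>C. dcycle A C \<longrightarrow> 1 \<le> cycle_weight w C)" for w
  define tight where
    "tight w e \<longleftrightarrow> (\<exists>C. dcycle A C \<and> last C = fst e \<and> hd C = snd e \<and> cycle_weight w C = 1)" for w e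
  \<comment> \<open>Induction over the arcs made tight so far.\<close>
  have "\<exists>w. feasible w \<and> (\<forall>e\<in>F. tight w e)" if "finite F" "F \<subseteq> A" for F
    using that
  proof induction
    case empty
    have "feasible (\<lambda>e. 1)"
      unfolding feasible_def
    proof (intro allI impI)
      fix C
      assume "dcycle A C"
      then show "1 \<le> cycle_weight (\<lambda>e. 1) C"
        using walk_weight_affine[of "C @ [hd C]" 1 0] by (cases C) (auto simp: cycle_weight_def dcycle_def)
    qed
    then show ?case
      by blast
  next
    case (insert e F)
    then obtain w where w: "feasible w" "\<And>f. f \<in> F \<Longrightarrow> tight w f"
      by auto
    obtain u v where e: "e = (u, v)"
      by fastforce
    \<comment> \<open>The cycles through \<open>e\<close>, written with \<open>e\<close> as closing
      arc: finitely many, and at least one by strong connectivity.\<close>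
    define Cs where "Cs = {C. dcycle A C \<and> last C = u \<and> hd C = v}"
    have uv: "(u, v) \<in> A" "u \<in> V" "v \<in> V"
      using insert.prems AV e by auto
    have "Cs \<subseteq> {C. set C \<subseteq> V \<and> distinct C}"
      using dcycle_subset[OF _ AV] by (auto simp: Cs_def dcycle_def)
    then have "finite Cs"
      using finite_subset_distinct[OF finV] finite_subset by blast
    have "(v, u) \<in> (A \<inter> V \<times> V)\<^sup>*"
      using D(2) uv AV by (simp add: strongly_connected_def Int_absorb2)
    then obtain p where "dpath A p v u"
      using dpath_in_reachable uv by metis
    then have "p \<in> Cs"
      using uv by (auto simp: Cs_def dcycle_def dpath_iff)
    define t where "t = Min (cycle_weight w ` Cs)"
    have "t \<in> cycle_weight w ` Cs"
      unfolding t_def using \<open>finite Cs\<close> \<open>p \<in> Cs\<close> by (intro Min_in) auto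
    then obtain C0 where C0: "C0 \<in> Cs" "cycle_weight w C0 = t"
      by blast
    have t_le: "t \<le> cycle_weight w C" if "C \<in> Cs" for C
      unfolding t_def using \<open>finite Cs\<close> that by simp
    have t: "1 \<le> t"
      using C0 w(1) by (auto simp: feasible_def Cs_def)
    \<comment> \<open>Lightening \<open>e\<close> by \<open>t - 1\<close> brings the lightest cycle
      through \<open>e\<close> to weight exactly 1. This may make the weight of \<open>e\<close>
      negative, so weights are integers.\<close>
    define w' where "w' = w((u, v) := w (u, v) - (t - 1))"
    have w'_Cs: "cycle_weight w' C = cycle_weight w C - (t - 1)" if "C \<in> Cs" for C
      using that cycle_weight_fun_upd_last[of A C u v w "w (u, v) - (t - 1)"]
      by (simp add: w'_def Cs_def)
    have "1 \<le> cycle_weight w' C" if C: "dcycle A C" for C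
    proof (rule cycle_weight_fun_upd[OF C, of w u v "w (u, v) - (t - 1)"])
      assume "cycle_weight (w((u, v) := w (u, v) - (t - 1))) C = cycle_weight w C"
      then show ?thesis
        using w(1) C by (simp add: w'_def feasible_def)
    next
      fix C'
      assume "dcycle A C'" "last C' = u" "hd C' = v" "\<And>w. cycle_weight w C' = cycle_weight w C"
      then show ?thesis
        using w'_Cs[of C'] t_le[of C'] by (simp add: Cs_def)
    qed
    then have feas: "feasible w'"
      by (simp add: feasible_def)
    \<comment> \<open>No weight increases, so by feasibility a cycle of weight 1 keeps it and the
      earlier arcs stay tight.\<close>
    have "w' f \<le> w f" for f
      using t by (simp add: w'_def)
    then have w'_le: "cycle_weight w' C \<le> cycle_weight w C" for C
      unfolding cycle_weight_def by (rule walk_weight_mono)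
    have "tight w' f" if f: "f \<in> F" for f
    proof -
      obtain C where C: "dcycle A C" "last C = fst f" "hd C = snd f" "cycle_weight w C = 1"
        using w(2)[OF f] by (auto simp: tight_def)
      then have "cycle_weight w' C = 1"
        using w'_le[of C] feas by (simp add: feasible_def order_antisym)
      with C show ?thesis
        by (auto simp: tight_def)
    qed
    moreover have "tight w' e"
      unfolding tight_def using C0 w'_Cs[OF C0(1)] e by (intro exI[of _ C0]) (simp add: Cs_def)
    ultimately show ?case
      using feas by blast
  qed
  moreover have "finite A"
    using AV finV by (meson finite_SigmaI finite_subset)
  ultimately obtain w where "feasible w" "\<forall>e\<in>A. tight w e"
    by blast
  then show thesis
    unfolding feasible_def tight_def by (intro that[of w]) fastforce+
qed

text \<open>The potential of \<open>v\<close> is the greatest weight of a path ending at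
  \<open>v\<close>. If the arc \<open>(u, v)\<close> returns to a vertex of the best path to
  \<open>u\<close>, it closes a cycle of weight at most 0, and cutting that cycle off loses
  nothing.\<close>

lemma potential_exists:
  fixes A :: "('a \<times> 'a) set" and l :: "'a \<times> 'a \<Rightarrow> int"
  assumes fin: "finite V" and AV: "A \<subseteq> V \<times> V"
    and nonpos: "\<And>C. dcycle A C \<Longrightarrow> cycle_weight l C \<le> 0"
  obtains pot where "\<And>u v. (u, v) \<in> A \<Longrightarrow> pot u + l (u, v) \<le> pot v"
proof -
  define S where
    "S v = {p. p \<noteq> [] \<and> set p \<subseteq> V \<and> distinct p \<and> successively (\<lambda>a b. (a, b) \<in> A) p \<and> last p = v}" for v
  define pot where "pot v = Max (walk_weight l ` S v)" for v
  have fin_S: "finite (S v)" for v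
    by (rule finite_subset[OF _ finite_subset_distinct[OF fin]]) (auto simp: S_def)
  have le_pot: "walk_weight l p \<le> pot v" if "p \<in> S v" for p v
    unfolding pot_def using fin_S that by simp
  have "pot u + l (u, v) \<le> pot v" if uv: "(u, v) \<in> A" for u v
  proof -
    have "u \<in> V" "v \<in> V"
      using uv AV by auto
    then have "[u] \<in> S u"
      by (simp add: S_def)
    then have "pot u \<in> walk_weight l ` S u"
      unfolding pot_def using fin_S by (intro Max_in) auto
    then obtain p where p: "p \<in> S u" "pot u = walk_weight l p"
      by blast
    show ?thesis
    proof (cases "v \<in> set p")
      case False
      then have "p @ [v] \<in> S v"
        using p(1) uv \<open>v \<in> V\<close> by (auto simp: S_def successively_append_iff)
      then show ?thesis
        using le_pot[of "p @ [v]" v] p by (simp add: walk_weight_snoc S_def)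
    next
      case True
      then obtain p1 p2 where p12: "p = p1 @ v # p2"
        by (auto simp: in_set_conv_decomp)
      then have "dcycle A (v # p2)" "p1 @ [v] \<in> S v" "last (v # p2) = u"
        using p(1) uv by (auto simp: S_def dcycle_def successively_append_iff)
      then show ?thesis
        using nonpos[of "v # p2"] le_pot[of "p1 @ [v]" v] p(2) p12 walk_weight_append[of l p1 v p2]
        by (simp add: cycle_weight_eq del: last.simps)
    qed
  qed
  then show thesis
    using that by blast
qed

text \<open>Bondy's theorem that a strong digraph has a cycle of length at least its chromatic number. The
  arc lengths 1 - m w admit a potential since no cycle is positive; along an arc that lies on a cycle of
  weight 1 the potential never changes by a multiple of m.\<close>
lemma colouring_if_cycles_short:
  fixes A :: "('a \<times> 'a) set"
  assumes D: "digraph V A" "strongly_connected V A" and m: "1 \<le> m"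
    and short: "\<And>C. dcycle A C \<Longrightarrow> length C \<le> m"
  shows "\<exists>c. proper_colouring V A m c"
proof -
  obtain w where feasible: "\<And>C. dcycle A C \<Longrightarrow> 1 \<le> cycle_weight w C"
    and tight: "\<And>u v. (u, v) \<in> A \<Longrightarrow> \<exists>C. dcycle A C \<and> last C = u \<and> hd C = v \<and> cycle_weight w C = 1"
    using tight_weighting[OF D] by metis
  define l where "l e = 1 - int m * w e" for e
  have l_eq: "walk_weight l p = int (length p) - 1 - int m * walk_weight w p" if "p \<noteq> []" for p
    using walk_weight_affine[OF that, of 1 "int m" w] by (simp add: l_def[abs_def])
  \<comment> \<open>The weight of a cycle under \<open>l\<close> is its length minus
    \<open>m\<close> times its weight under \<open>w\<close>, hence at most
    \<open>m - m\<close>.\<close>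
  have "cycle_weight l C \<le> 0" if C: "dcycle A C" for C
  proof -
    have "int m * 1 \<le> int m * cycle_weight w C"
      by (rule mult_left_mono) (use feasible[OF C] in auto)
    then show ?thesis
      using short[OF C] l_eq[of "C @ [hd C]"] by (simp add: cycle_weight_def)
  qed
  then obtain pot where pot: "\<And>u v. (u, v) \<in> A \<Longrightarrow> pot u + l (u, v) \<le> pot v"
    using potential_exists[of V A l] D(1) by (auto simp: digraph_def)
  have pot_path: "pot (hd p) + walk_weight l p \<le> pot (last p)"
    if "p \<noteq> []" "successively (\<lambda>a b. (a, b) \<in> A) p" for p
    using that
  proof (induction p rule: induct_list012)
    case (3 x y zs)
    then show ?case
      using pot[of x y] by auto
  qed auto
  have "nat (pot u mod int m) \<noteq> nat (pot v mod int m)" if uv: "(u, v) \<in> A" for u v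
  proof
    assume "nat (pot u mod int m) = nat (pot v mod int m)"
    then have "pot u mod int m = pot v mod int m"
      using m by (simp add: nat_eq_iff)
    then have "int m dvd pot v - pot u"
      by (metis mod_eq_dvd_iff)
    \<comment> \<open>This multiple of \<open>m\<close> is at least 1, by the potential inequality
      for the arc. Following the tight cycle from \<open>v\<close> to \<open>u\<close> shows that it
      is at most \<open>m + 1 - length C\<close>, hence at most \<open>m - 1\<close>.\<close>
    then have dvd: "int m dvd pot v - pot u + int m * w (u, v)"
      by simp
    obtain C where C: "dcycle A C" "last C = u" "hd C = v" "cycle_weight w C = 1"
      using tight[OF uv] by blast
    then have "C \<noteq> []" "u \<noteq> v" "pot v + walk_weight l C \<le> pot u"
      using pot_path[of C] D(1) uv by (auto simp: dcycle_def digraph_def)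
    moreover have "2 \<le> length C"
      using C(2,3) \<open>u \<noteq> v\<close> \<open>C \<noteq> []\<close> by (cases C; cases "tl C") auto
    moreover have "walk_weight w C = 1 - w (u, v)"
      using C \<open>C \<noteq> []\<close> by (simp add: cycle_weight_eq)
    ultimately have "pot v - pot u + int m * w (u, v) \<le> int m - 1"
      using l_eq[of C] by (simp add: algebra_simps)
    moreover have "1 \<le> pot v - pot u + int m * w (u, v)"
      using pot[OF uv] by (simp add: l_def)
    ultimately show False
      using zdvd_imp_le[OF dvd] by linarith
  qed
  moreover have "nat (pot v mod int m) < m" for v
    using m by (simp add: nat_less_iff)
  ultimately have "proper_colouring V A m (\<lambda>v. nat (pot v mod int m))"
    by (auto simp: proper_colouring_def)
  then show ?thesis
    by blast
qed

section \<open>Partitions and quotient digraphs\<close>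

lemma dcycle_nth:
  assumes "dcycle A C" "i < length C"
  shows "(C ! i, C ! (Suc i mod length C)) \<in> A"
proof (cases "Suc i = length C")
  case True
  then have "last C = C ! i" "hd C = C ! 0"
    using assms by (auto simp: dcycle_def last_conv_nth hd_conv_nth simp flip: True)
  then show ?thesis
    using assms True by (simp add: dcycle_def)
next
  case False
  then show ?thesis
    using assms by (simp add: dcycle_def successively_conv_nth)
qed

lemma dcycle_rotate: "dcycle A C \<Longrightarrow> dcycle A (rotate i C)"
  by (metis append_take_drop_id dcycle_swap rotate_drop_take)

lemma Int_Union_empty_if_pairwise_disjnt:
  assumes "pairwise disjnt P" "S \<in> P" "Q \<subseteq> P" "S \<notin> Q"
  shows "S \<inter> \<Union>Q = {}"
proof -
  have "S \<inter> X = {}" if "X \<in> Q" for X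
    using pairwiseD[OF assms(1,2), of X] that assms(3,4) by (auto simp: disjnt_def)
  then show ?thesis
    by blast
qed

definition quotient_arcs :: "('a \<times> 'a) set \<Rightarrow> 'a set set \<Rightarrow> ('a set \<times> 'a set) set" where
  "quotient_arcs A P = {(S, T). S \<in> P \<and> T \<in> P \<and> S \<noteq> T \<and> (\<exists>s\<in>S. \<exists>t\<in>T. (s, t) \<in> A)}"

lemma quotient_strongly_connected:
  assumes AV: "A \<subseteq> V \<times> V" and strong: "strongly_connected V A"
    and P: "\<Union>P = V" "pairwise disjnt P" "{} \<notin> P"
  shows "strongly_connected P (quotient_arcs A P)"
proof -
  have reach: "\<forall>T\<in>P. t \<in> T \<longrightarrow> (S, T) \<in> (quotient_arcs A P)\<^sup>*"
    if "(s, t) \<in> A\<^sup>*" "S \<in> P" "s \<in> S" for s t S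
    using that(1)
  proof induction
    case base
    have "S = T" if "T \<in> P" "s \<in> T" for T
      using P(2) \<open>S \<in> P\<close> \<open>s \<in> S\<close> that by (metis disjnt_iff pairwiseD)
    then show ?case
      by blast
  next
    case (step y z)
    then obtain Y where Y: "Y \<in> P" "y \<in> Y" "(S, Y) \<in> (quotient_arcs A P)\<^sup>*"
      using AV P(1) by blast
    show ?case
    proof (intro ballI impI)
      fix T
      assume "T \<in> P" "z \<in> T"
      then have "Y = T \<or> (Y, T) \<in> quotient_arcs A P"
        using Y step.hyps(2) by (auto simp: quotient_arcs_def)
      then show "(S, T) \<in> (quotient_arcs A P)\<^sup>*"
        using Y(3) by (auto intro: rtrancl_into_rtrancl)
    qed
  qed
  show ?thesis
    unfolding strongly_connected_def
  proof (intro ballI)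
    fix S T
    assume ST: "S \<in> P" "T \<in> P"
    then obtain s t where "s \<in> S" "t \<in> T"
      using P(3) by (metis ex_in_conv)
    moreover have "(s, t) \<in> A\<^sup>*"
      using strong ST P(1) calculation by (auto simp: strongly_connected_def)
    ultimately show "(S, T) \<in> (quotient_arcs A P)\<^sup>*"
      using reach ST by blast
  qed
qed

text \<open>A pair of colours, one for the class and one inside it, is encoded as quotient and
  remainder modulo \<open>n\<close>. The quotients differ along arcs between classes, the remainders
  along arcs within a class.\<close>

lemma product_colouring:
  assumes P: "\<Union>P = V" "pairwise disjnt P"
    and AV: "A \<subseteq> V \<times> V"
    and c: "proper_colouring P (quotient_arcs A P) m c"
    and blocks: "\<And>S. S \<in> P \<Longrightarrow> \<exists>d. proper_colouring S (A \<inter> S \<times> S) n d"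
  shows "\<exists>f. proper_colouring V A (n * m) f"
proof -
  obtain d where d: "\<And>S. S \<in> P \<Longrightarrow> proper_colouring S (A \<inter> S \<times> S) n (d S)"
    using blocks by metis
  define own where "own v = (SOME S. S \<in> P \<and> v \<in> S)" for v
  have own: "own v \<in> P \<and> v \<in> own v" if "v \<in> V" for v
    unfolding own_def by (rule someI_ex) (use that P(1) in blast)
  define f where "f v = c (own v) * n + d (own v) v" for v
  have d_lt: "d (own v) v < n" and c_lt: "c (own v) < m" if "v \<in> V" for v
    using own[OF that] d c by (auto simp: proper_colouring_def)
  have "f v < n * m" if "v \<in> V" for v
  proof -
    have "f v < (c (own v) + 1) * n"
      using d_lt[OF that] by (simp add: f_def)
    also have "\<dots> \<le> m * n"
      using c_lt[OF that] by (intro mult_le_mono1) simp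
    finally show ?thesis
      by (simp add: mult.commute)
  qed
  moreover have "f u \<noteq> f v" if uv: "(u, v) \<in> A" for u v
  proof
    assume "f u = f v"
    have V: "u \<in> V" "v \<in> V"
      using uv AV by auto
    have f_div: "f x div n = c (own x)" and f_mod: "f x mod n = d (own x) x" if "x \<in> V" for x
      using d_lt[OF that] by (auto simp: f_def)
    then have eq: "c (own u) = c (own v)" "d (own u) u = d (own v) v"
      using \<open>f u = f v\<close> V by metis+
    show False
    proof (cases "own u = own v")
      case True
      then have "(u, v) \<in> A \<inter> own u \<times> own u" "own u \<in> P"
        using own[OF V(1)] own[OF V(2)] uv by auto
      then show ?thesis
        using eq(2) d[of "own u"] True by (auto simp: proper_colouring_def)
    next
      case False
      then have "(own u, own v) \<in> quotient_arcs A P"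
        using own V uv by (auto simp: quotient_arcs_def)
      then show ?thesis
        using c eq(1) by (auto simp: proper_colouring_def)
    qed
  qed
  ultimately have "proper_colouring V A (n * m) f"
    by (auto simp: proper_colouring_def)
  then show ?thesis
    by blast
qed

section \<open>Lifting long cycles of the quotient\<close>

context bispindle_free
begin

text \<open>Within each block a path joins the entry vertex to the exit vertex. Disjointness makes
  the concatenation a path, and each block contributes at least one vertex.\<close>

lemma path_through_blocks:
  assumes "Ss \<noteq> []" "successively (\<lambda>S T. (S, T) \<in> quotient_arcs A P) Ss" "distinct Ss" "set Ss \<subseteq> P"
    and P: "pairwise disjnt P" "\<And>S. S \<in> P \<Longrightarrow> block S"
    and "s \<in> hd Ss" "t \<in> last Ss"
  shows "\<exists>p. dpath A p s t \<and> set p \<subseteq> \<Union>(set Ss) \<and> length Ss \<le> length p"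
  using assms(1-4,7,8)
proof (induction Ss arbitrary: s rule: induct_list012)
  case (2 S)
  then obtain p where "dpath A p s t" "set p \<subseteq> S"
    using block_path[of S s t] P(2) by auto
  then show ?case
    by (intro exI[of _ p]) (auto simp: dpath_iff Suc_le_eq)
next
  case (3 S S' Ss)
  then obtain s' t' where st: "s' \<in> S" "t' \<in> S'" "(s', t') \<in> A"
    by (auto simp: quotient_arcs_def)
  obtain p where p: "dpath A p s s'" "set p \<subseteq> S"
    using block_path[of S s s'] P(2) 3 st by auto
  obtain q where q: "dpath A q t' t" "set q \<subseteq> \<Union>(set (S' # Ss))" "length (S' # Ss) \<le> length q"
    using 3 st by fastforce
  have "S \<inter> \<Union>(set (S' # Ss)) = {}"
    by (rule Int_Union_empty_if_pairwise_disjnt[OF P(1)]) (use "3.prems"(3,4) in auto)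
  then have "dpath A (p @ q) s t"
    using dpath_append[OF p(1) q(1) st(3)] p(2) q(2) by blast
  moreover have "set (p @ q) \<subseteq> \<Union>(set (S # S' # Ss))"
    using p(2) q(2) by auto
  moreover have "length (S # S' # Ss) \<le> length (p @ q)"
    using p(1) q(3) by (cases p) (auto simp: dpath_iff)
  ultimately show ?case
    by blast
qed simp

text \<open>If \<open>u \<noteq> w\<close>, a path from \<open>u\<close> through the other blocks
  back to \<open>w\<close> is an ear of \<open>S\<close> of length at least
  \<open>length (S # Ss)\<close>, which is at least \<open>k\<close>.\<close>

lemma contact_vertex_unique:
  assumes C: "dcycle (quotient_arcs A P) (S # Ss)" and len: "2 * k - 2 \<le> length (S # Ss)"
    and P: "pairwise disjnt P" "\<And>S. S \<in> P \<Longrightarrow> block S"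
    and out: "u \<in> S" "(u, u') \<in> A" "u' \<in> hd Ss"
    and "in": "w \<in> S" "(w', w) \<in> A" "w' \<in> last Ss"
  shows "u = w"
proof (rule ccontr)
  assume "u \<noteq> w"
  have "Ss \<noteq> []"
    using len three_le_k by auto
  have sub: "set (S # Ss) \<subseteq> P"
    by (rule dcycle_subset[OF C]) (auto simp: quotient_arcs_def)
  have "successively (\<lambda>S T. (S, T) \<in> quotient_arcs A P) Ss" "distinct Ss"
    using C \<open>Ss \<noteq> []\<close> by (auto simp: dcycle_def successively_Cons)
  then obtain p where p: "dpath A p u' w'" "set p \<subseteq> \<Union>(set Ss)" "length Ss \<le> length p"
    using path_through_blocks[OF \<open>Ss \<noteq> []\<close> _ _ _ P out(3) "in"(3)] sub by auto
  have "S \<inter> \<Union>(set Ss) = {}"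
    by (rule Int_Union_empty_if_pairwise_disjnt[OF P(1)]) (use C sub in \<open>auto simp: dcycle_def\<close>)
  then have int: "set p \<inter> S = {}"
    using p(2) by blast
  have "dpath A [u] u u" "dpath A [w] w w"
    by (auto simp: dpath_iff)
  then have "dpath A ([u] @ p @ [w]) u w"
    using p(1) out "in" int \<open>u \<noteq> w\<close> by (intro dpath_append[of A _ u u _ u'] dpath_append[of A p u' w' _ w]) auto
  moreover have "block S"
    using P(2) sub by simp
  ultimately have "plen ([u] @ p @ [w]) < k"
    using block_ear[of S u w] out(1) "in"(1) \<open>u \<noteq> w\<close> int by auto
  then show False
    using p(3) len three_le_k by (simp add: plen_def)
qed

text \<open>One arc is chosen from each block to the next. By \<open>contact_vertex_unique\<close>
  it ends where the next chosen arc starts, so the tails form a cycle \<open>D\<close> with one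
  vertex in each block, and \<open>Union_blocks\<close> applies.\<close>

lemma block_Union_quotient_cycle:
  assumes C: "dcycle (quotient_arcs A P) Ss" and len: "2 * k - 2 \<le> length Ss"
    and P: "pairwise disjnt P" "\<And>S. S \<in> P \<Longrightarrow> block S"
  shows "block (\<Union>(set Ss))"
proof -
  define n where "n = length Ss"
  have n: "4 \<le> n"
    using len three_le_k by (simp add: n_def)
  have sub: "set Ss \<subseteq> P"
    by (rule dcycle_subset[OF C]) (auto simp: quotient_arcs_def)
  have "\<forall>i\<in>{..<n}. \<exists>e. fst e \<in> Ss ! i \<and> snd e \<in> Ss ! (Suc i mod n) \<and> e \<in> A"
    using dcycle_nth[OF C] by (fastforce simp: n_def quotient_arcs_def)
  then obtain e where e: "\<And>i. i < n \<Longrightarrow> fst (e i) \<in> Ss ! i \<and> snd (e i) \<in> Ss ! (Suc i mod n) \<and> e i \<in> A"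
    by (metis lessThan_iff)
  define a where "a i = fst (e i)" for i
  have a_next: "a (Suc i mod n) = snd (e i)" if i: "i < n" for i
  proof -
    let ?j = "Suc i mod n"
    have j: "?j < n"
      using n by simp
    \<comment> \<open>Rotation puts block \<open>?j\<close> first, so that its successor is
      \<open>hd Rs\<close> and its predecessor, block \<open>i\<close>, is
      \<open>last Rs\<close>.\<close>
    obtain S Rs where rot: "rotate (Suc i) Ss = S # Rs"
      using n by (cases "rotate (Suc i) Ss") (auto simp: n_def)
    have lenR: "Suc (length Rs) = n"
      using rot by (metis length_Cons length_rotate n_def)
    have nth: "(S # Rs) ! l = Ss ! ((Suc i + l) mod n)" if "l < n" for l
      using that rot nth_rotate[of l Ss "Suc i"] by (simp add: n_def)
    have S: "S = Ss ! ?j"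
      using nth[of 0] n by simp
    have "Rs \<noteq> []"
      using lenR n by auto
    then have "hd Rs = (S # Rs) ! 1" "last Rs = (S # Rs) ! (n - 1)"
      using lenR n by (auto simp: hd_conv_nth last_conv_nth nth_Cons' simp flip: lenR)
    then have "hd Rs = Ss ! (Suc ?j mod n)" "last Rs = Ss ! i"
      using nth[of 1] nth[of "n - 1"] n i by (auto simp: mod_Suc_eq)
    moreover have "dcycle (quotient_arcs A P) (S # Rs)"
      using dcycle_rotate[OF C, of "Suc i"] rot by simp
    moreover have "2 * k - 2 \<le> length (S # Rs)"
      using len lenR n_def by simp
    ultimately show ?thesis
      using contact_vertex_unique[OF _ _ P, of S Rs "a ?j" "snd (e ?j)" "snd (e i)" "a i"] e[OF i] e[OF j] S
      by (simp add: a_def)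
  qed
  define D where "D = map a [0..<n]"
  \<comment> \<open>For \<open>x\<close> on \<open>D\<close> exactly one block of the cycle contains
    \<open>x\<close>, and \<open>T x\<close> is that block.\<close>
  define T where "T x = \<Union>{S \<in> set Ss. x \<in> S}" for x
  have lenD: "length D = n" and D_nth: "\<And>i. i < n \<Longrightarrow> D ! i = a i"
    by (auto simp: D_def)
  have a_mem: "a i \<in> Ss ! i" if "i < n" for i
    using e[OF that] by (simp add: a_def)
  have Ss_disj: "Ss ! i \<inter> Ss ! j = {}" if "i < n" "j < n" "i \<noteq> j" for i j
  proof -
    have "Ss ! i \<noteq> Ss ! j"
      using C that by (simp add: dcycle_def n_def nth_eq_iff_index_eq)
    moreover have "Ss ! i \<in> P" "Ss ! j \<in> P"
      using sub that by (auto simp: n_def)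
    ultimately show ?thesis
      using P(1) by (auto simp: pairwise_def disjnt_def)
  qed
  have T_a: "T (a i) = Ss ! i" if i: "i < n" for i
  proof -
    have "S = Ss ! i" if S: "S \<in> set Ss" "a i \<in> S" for S
    proof -
      obtain j where "j < n" "S = Ss ! j"
        using S(1) by (auto simp: in_set_conv_nth n_def)
      then show ?thesis
        using Ss_disj[of i j] i a_mem[OF i] S(2) by blast
    qed
    moreover have "Ss ! i \<in> set Ss"
      using i by (simp add: n_def)
    ultimately have "{S \<in> set Ss. a i \<in> S} = {Ss ! i}"
      using a_mem[OF i] by blast
    then show ?thesis
      by (simp add: T_def)
  qed
  have a_inj: "a i \<noteq> a j" if "i < n" "j < n" "i \<noteq> j" for i j
    using Ss_disj[OF that] a_mem that by (metis disjoint_iff)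
  have set_D: "set D = a ` {..<n}"
    by (auto simp: D_def)
  have arc: "(a i, a (Suc i mod n)) \<in> A" if "i < n" for i
    using a_next[OF that] e[OF that] by (simp add: a_def)
  have "distinct D"
    using a_inj by (auto simp: D_def distinct_map intro!: inj_onI) blast
  moreover have "D \<noteq> []"
    using lenD n by auto
  moreover have "successively (\<lambda>x y. (x, y) \<in> A) D"
    unfolding successively_conv_nth
  proof (intro allI impI)
    fix i
    assume "Suc i < length D"
    then show "(D ! i, D ! Suc i) \<in> A"
      using arc[of i] by (simp add: lenD D_nth)
  qed
  moreover have "(last D, hd D) \<in> A"
    using arc[of "n - 1"] n lenD D_nth \<open>D \<noteq> []\<close> by (simp add: last_conv_nth hd_conv_nth)
  ultimately have D: "dcycle A D"
    by (simp add: dcycle_def)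
  have "block (\<Union>x\<in>set D. T x)"
  proof (rule Union_blocks[OF D])
    fix x
    assume "x \<in> set D"
    then obtain i where i: "i < n" "x = a i"
      by (auto simp: set_D)
    moreover have "Ss ! i \<in> P"
      using i(1) sub by (auto simp: n_def)
    ultimately show "block (T x)" "x \<in> T x"
      using T_a a_mem P(2) by auto
    fix y
    assume "y \<in> set D" "x \<noteq> y"
    then obtain j where "j < n" "y = a j"
      by (auto simp: set_D)
    then show "T x \<inter> T y = {}"
      using i T_a Ss_disj[of i j] \<open>x \<noteq> y\<close> by auto
  next
    show "2 * k - 2 \<le> length D"
      using len lenD n_def by simp
    then show "\<exists>c. proper_colouring (set D) (A \<inter> set D \<times> set D) (2 * k - 2) c"
      by (rule cycle_colouring[OF D])
  qed
  moreover have "(\<Union>x\<in>set D. T x) = \<Union>(set Ss)"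
  proof -
    have "(\<Union>x\<in>set D. T x) = (\<Union>i<n. Ss ! i)"
      using T_a by (simp add: set_D)
    also have "\<dots> = \<Union>(set Ss)"
      by (auto simp: n_def set_conv_nth)
    finally show ?thesis .
  qed
  ultimately show ?thesis
    by simp
qed

text \<open>In a partition with the fewest blocks, starting from singletons to have one at all, a
  longer quotient cycle could be merged into a single block. It has at least 4 entries, so this
  would lower the number of blocks.\<close>

lemma block_partition:
  assumes "finite V"
  obtains P where "\<Union>P = V" "pairwise disjnt P" "\<And>S. S \<in> P \<Longrightarrow> block S"
    "\<And>C. dcycle (quotient_arcs A P) C \<Longrightarrow> length C \<le> 2 * k - 3"
proof -
  define good where "good P \<longleftrightarrow> \<Union>P = V \<and> pairwise disjnt P \<and> (\<forall>S\<in>P. block S)" for P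
  have "good ((\<lambda>v. {v}) ` V)"
    using block_singleton by (auto simp: good_def pairwise_def)
  then obtain P where P: "good P" and P_min: "\<And>P'. good P' \<Longrightarrow> card P \<le> card P'"
    using ex_has_least_nat[of good _ card] by blast
  have "finite P"
    using P assms by (metis finite_UnionD good_def)
  have "length C \<le> 2 * k - 3" if C: "dcycle (quotient_arcs A P) C" for C
  proof (rule ccontr)
    assume "\<not> ?thesis"
    then have len: "2 * k - 2 \<le> length C"
      by simp
    have sub: "set C \<subseteq> P"
      by (rule dcycle_subset[OF C]) (auto simp: quotient_arcs_def)
    define P' where "P' = insert (\<Union>(set C)) (P - set C)"
    have "block (\<Union>(set C))"
      using block_Union_quotient_cycle[OF C len] P by (auto simp: good_def)
    moreover have "disjnt S T" if "S \<in> P" "T \<in> P" "S \<noteq> T" for S T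
      using P that by (auto simp: good_def pairwise_def)
    ultimately have "good P'"
      using P sub by (auto simp: good_def P'_def pairwise_insert disjnt_Union1 disjnt_Union2 pairwise_def)
    then have "card P \<le> card P'"
      by (rule P_min)
    also have "\<dots> \<le> Suc (card (P - set C))"
      by (simp add: P'_def card_insert_le_m1 \<open>finite P\<close> card_insert_if)
    also have "\<dots> = Suc (card P - length C)"
      using C sub by (simp add: card_Diff_subset distinct_card dcycle_def)
    finally have "card P \<le> Suc (card P - length C)" .
    moreover have "length C \<le> card P"
      using C sub \<open>finite P\<close> by (metis card_mono dcycle_def distinct_card)
    ultimately show False
      using len three_le_k by linarith
  qed
  then show thesis
    using that[of P] P by (auto simp: good_def)
qed

end

theorem mainTheorem3:
  fixes V :: "'a set" and A :: "('a \<times> 'a) set" and k :: nat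
  assumes "k \<ge> 3"
    and "digraph V A"
    and "strongly_connected V A"
    and "chromatic_number V A > (2 * k - 2) * (2 * k - 3)"
  shows "contains_subdiv_B A k 1 1"
proof (rule ccontr)
  assume "\<not> ?thesis"
  with assms(1,2) interpret bispindle_free A k
    by unfold_locales (auto simp: digraph_def)
  have AV: "A \<subseteq> V \<times> V" and "finite V"
    using assms(2) by (auto simp: digraph_def)
  obtain P where P: "\<Union>P = V" "pairwise disjnt P" "\<And>S. S \<in> P \<Longrightarrow> block S"
    and short: "\<And>C. dcycle (quotient_arcs A P) C \<Longrightarrow> length C \<le> 2 * k - 3"
    using block_partition[OF \<open>finite V\<close>] by blast
  have "digraph P (quotient_arcs A P)"
    using P(1) \<open>finite V\<close> by (auto simp: digraph_def quotient_arcs_def intro: finite_UnionD)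
  moreover have "strongly_connected P (quotient_arcs A P)"
    using quotient_strongly_connected[OF AV assms(3) P(1,2)] P(3) by (auto simp: block_def)
  moreover have "1 \<le> 2 * k - 3"
    using assms(1) by simp
  ultimately obtain c where c: "proper_colouring P (quotient_arcs A P) (2 * k - 3) c"
    using colouring_if_cycles_short short by metis
  have "\<exists>f. proper_colouring V A ((2 * k - 2) * (2 * k - 3)) f"
    using product_colouring[OF P(1,2) AV c] P(3) by (auto simp: block_def)
  then have "chromatic_number V A \<le> (2 * k - 2) * (2 * k - 3)"
    unfolding chromatic_number_def by (rule Least_le)
  then show False
    using assms(4) by simp
qed

end
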